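(* Let a receiver array be given, with element power pattern $g$, steering map $\mathbf a$ and direction discrepancy $d_{\mathrm a}$ satisfying the boundedness and Lipschitz conditions with constants $g_{\max},A,L_{\mathrm a}$ stated in the context. Then there are constants $C_m,C_\Omega\ge 0$, depending only on the receiver array, such that the following holds. For every target power spectrum $P$, every number $K$ of components, every line-of-sight direction $\Omega_{\mathrm{los}}$, every compact admissible set $\mathcal Z_K$ of renderer states, every best-approximating state $\mathbf z^\star\in\arg\min_{\mathbf z\in\mathcal Z_K}\|P-\mathcal B(\mathbf z)\|_\infty$, every estimated state $\widehat{\mathbf z}$ with rendered spectrum $\widehat P=\mathcal B(\widehat{\mathbf z})$, and every matching permutation $\upsilon$ of $\{1,\dots,K\}$, $$\left\|\widehat P-P\right\|_\infty\le \varepsilon_{\mathrm{phys}}+C_mE_m+C_\Omega E_\Omega ,$$ where $\varepsilon_{\mathrm{phys}}$, $E_m$ and $E_\Omega$ are the representation error, the matched power error and the matched power-weighted direction error defined in the context.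
   Context: Array. $\mathcal D$ is the space of arrival directions, $\mathcal G\subset\mathcal D$ a finite angular grid, and $\|\cdot\|_\infty$ is the maximum over $\mathcal G$. $N$ is the number of array elements, $\mathbf a:\mathcal D\to\mathbb C^N$ is the (continuous) steering map, $g$ is the real-valued element power pattern, and $d_{\mathrm a}:\mathcal D\times\mathcal D\to[0,\infty)$ is a direction discrepancy. The array response is bounded and Lipschitz: for all directions $\Omega,\Omega'$, $$0\le g(\Omega)\le g_{\max},\qquad \|\mathbf a(\Omega)\|_2\le A,\qquad \|\mathbf a(\Omega)-\mathbf a(\Omega')\|_2\le L_{\mathrm a}\,d_{\mathrm a}(\Omega,\Omega').$$ Renderer. A renderer state is $\mathbf z=\{(\Omega_n,m_n)\}_{n=0}^{K}$ with directions $\Omega_n\in\mathcal D$ and powers $m_n\ge 0$; index $n=0$ is the line-of-sight component, whose direction is always fixed to the known direction $\Omega_0=\Omega_{\mathrm{los}}$ while its power may vary. The rendered power spectrum is $$\mathcal B(\mathbf z)(\Omega)=g(\Omega)\sum_{n=0}^{K}m_n\left|\mathbf a(\Omega)^{\mathsf H}\mathbf a(\Omega_n)\right|^2,\qquad \Omega\in\mathcal G.$$ $\mathcal Z_K$ is a compact set of admissible renderer states (bounded nonnegative powers, admissible directions). The target power spectrum is a function $P:\mathcal G\to[0,\infty)$. Errors. With $\mathbf z^\star=\{(\Omega_n^\star,m_n^\star)\}_{n=0}^K$ a minimizer of $\|P-\mathcal B(\mathbf z)\|_\infty$ over $\mathcal Z_K$, set $\varepsilon_{\mathrm{phys}}=\|P-\mathcal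 B(\mathbf z^\star)\|_\infty$. For the estimated state $\widehat{\mathbf z}=\{(\widehat\Omega_n,\widehat m_n)\}_{n=0}^K$ (with $\widehat\Omega_0=\Omega_0^\star=\Omega_{\mathrm{los}}$) and a permutation $\upsilon$ of $\{1,\dots,K\}$, $$E_m=|\widehat m_0-m_0^\star|+\sum_{n=1}^K\left|\widehat m_{\upsilon(n)}-m_n^\star\right|,\qquad E_\Omega=\sum_{n=1}^K m_n^\star\, d_{\mathrm a}\!\left(\widehat\Omega_{\upsilon(n)},\Omega_n^\star\right).$$ *)

theory Defs
  imports "HOL-Analysis.Analysis"
begin

definition hermitian_prod :: "complex ^ 'n \<Rightarrow> complex ^ 'n \<Rightarrow> complex" where
  "hermitian_prod x y = (\<Sum>i\<in>UNIV. cnj (x $ i) * y $ i)"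

text \<open>Meaningful only for finite nonempty \<open>G\<close>.\<close>

definition max_norm :: "'d set \<Rightarrow> ('d \<Rightarrow> real) \<Rightarrow> real" where
  "max_norm G f = Max ((\<lambda>\<Omega>. \<bar>f \<Omega>\<bar>) ` G)"

text \<open>A state with components \<open>0, \<dots>, K\<close> is an extensional function on \<open>{..K}\<close> (equal to
  \<open>undefined\<close> elsewhere), so that the states are points of the \<open>(K + 1)\<close>-fold product space.\<close>

type_synonym 'd state = "nat \<Rightarrow> 'd \<times> real"

abbreviation direction :: "'d state \<Rightarrow> nat \<Rightarrow> 'd" where
  "direction z n \<equiv> fst (z n)"

abbreviation mass :: "'d state \<Rightarrow> nat \<Rightarrow> real" where
  "mass z n \<equiv> snd (z n)"

definition renderer_states :: "nat \<Rightarrow> 'd \<Rightarrow> 'd state set" where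
  "renderer_states K \<Omega>los =
     {z \<in> extensional {..K}. direction z 0 = \<Omega>los \<and> (\<forall>n\<le>K. 0 \<le> mass z n)}"

abbreviation state_topology :: "nat \<Rightarrow> ('d::topological_space) state topology" where
  "state_topology K \<equiv> product_topology (\<lambda>_. euclidean) {..K}"

text \<open>Boundedness of the powers is a consequence of compactness.\<close>

definition admissible_set :: "nat \<Rightarrow> 'd \<Rightarrow> ('d::topological_space) state set \<Rightarrow> bool" where
  "admissible_set K \<Omega>los Z \<longleftrightarrow> Z \<subseteq> renderer_states K \<Omega>los \<and> compactin (state_topology K) Z"

definition render ::
  "('d \<Rightarrow> real) \<Rightarrow> ('d \<Rightarrow> complex ^ 'n) \<Rightarrow> nat \<Rightarrow> 'd state \<Rightarrow> 'd \<Rightarrow> real" where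
  "render g a K z \<Omega> =
     g \<Omega> * (\<Sum>n=0..K. mass z n * (cmod (hermitian_prod (a \<Omega>) (a (direction z n))))\<^sup>2)"

definition fit_error ::
  "('d \<Rightarrow> real) \<Rightarrow> ('d \<Rightarrow> complex ^ 'n) \<Rightarrow> 'd set \<Rightarrow> nat \<Rightarrow> ('d \<Rightarrow> real) \<Rightarrow> 'd state \<Rightarrow> real" where
  "fit_error g a G K P z = max_norm G (\<lambda>\<Omega>. P \<Omega> - render g a K z \<Omega>)"

definition power_error :: "nat \<Rightarrow> (nat \<Rightarrow> nat) \<Rightarrow> 'd state \<Rightarrow> 'd state \<Rightarrow> real" where
  "power_error K \<upsilon> zhat zstar =
     \<bar>mass zhat 0 - mass zstar 0\<bar> + (\<Sum>n=1..K. \<bar>mass zhat (\<upsilon> n) - mass zstar n\<bar>)"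

definition direction_error ::
  "('d \<Rightarrow> 'd \<Rightarrow> real) \<Rightarrow> nat \<Rightarrow> (nat \<Rightarrow> nat) \<Rightarrow> 'd state \<Rightarrow> 'd state \<Rightarrow> real" where
  "direction_error da K \<upsilon> zhat zstar =
     (\<Sum>n=1..K. mass zstar n * da (direction zhat (\<upsilon> n)) (direction zstar n))"

end

theory Submission
  imports Defs
begin

text \<open>Matching the components by \<open>\<upsilon>\<close>, each difference of two rendered terms is split as
  \<open>m' q' - m q = (m' - m) q' + m (q' - q)\<close> with \<open>q = \<bar>a(\<Omega>)\<^sup>H a(\<Omega>\<^sub>n)\<bar>\<^sup>2 \<le> A^4\<close>, and \<open>q\<close> is Lipschitz in
  \<open>\<Omega>\<^sub>n\<close> with constant \<open>2 A^3 L\<^sub>a\<close> by Cauchy--Schwarz. The line-of-sight term has \<open>q' = q\<close>.\<close>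

text \<open>Cauchy-Schwarz: the triangle inequality reduces the claim to the moduli of the entries,
  where the real inequality for \<open>L2_set\<close> applies.\<close>

lemma cmod_hermitian_prod_le: "cmod (hermitian_prod x y) \<le> norm x * norm y"
proof -
  have "cmod (hermitian_prod x y) \<le> (\<Sum>i\<in>UNIV. \<bar>cmod (x $ i)\<bar> * \<bar>cmod (y $ i)\<bar>)"
    unfolding hermitian_prod_def by (rule order_trans[OF norm_sum]) (simp add: norm_mult)
  also have "\<dots> \<le> norm x * norm y"
    unfolding norm_vec_def by (rule L2_set_mult_ineq)
  finally show ?thesis .
qed

lemma hermitian_prod_diff_right:
  "hermitian_prod x (y - z) = hermitian_prod x y - hermitian_prod x z"
  by (simp add: hermitian_prod_def right_diff_distrib sum_subtractf)

lemma cmod_hermitian_prod_squared_le: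
  assumes "norm x \<le> A" "norm y \<le> A"
  shows "(cmod (hermitian_prod x y))\<^sup>2 \<le> A ^ 4"
proof -
  have "cmod (hermitian_prod x y) \<le> A * A"
    using assms by (intro order_trans[OF cmod_hermitian_prod_le] mult_mono)
      (auto intro: order_trans[OF norm_ge_zero])
  then have "(cmod (hermitian_prod x y))\<^sup>2 \<le> (A * A)\<^sup>2"
    by (intro power_mono) auto
  then show ?thesis
    by (simp add: power_def numeral_eq_Suc mult_ac)
qed

text \<open>Factor the difference of squares as \<open>\<bar>?u - ?v\<bar> * (?u + ?v)\<close>.
  Linearity in the second argument and Cauchy-Schwarz bound the first factor by
  \<open>A * norm (y - z)\<close>, and the second is at most \<open>2 * (A * A)\<close>.\<close>

lemma cmod_hermitian_prod_squared_diff_le: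
  assumes "norm x \<le> A" "norm y \<le> A" "norm z \<le> A"
  shows "\<bar>(cmod (hermitian_prod x y))\<^sup>2 - (cmod (hermitian_prod x z))\<^sup>2\<bar> \<le> 2 * A ^ 3 * norm (y - z)"
proof -
  let ?u = "cmod (hermitian_prod x y)" and ?v = "cmod (hermitian_prod x z)"
  have A: "0 \<le> A"
    using assms(1) norm_ge_zero order_trans by blast
  have "\<bar>?u - ?v\<bar> \<le> cmod (hermitian_prod x (y - z))"
    by (simp add: hermitian_prod_diff_right norm_triangle_ineq3)
  also have "\<dots> \<le> norm x * norm (y - z)"
    by (rule cmod_hermitian_prod_le)
  also have "\<dots> \<le> A * norm (y - z)"
    using assms by (intro mult_right_mono) auto
  finally have diff: "\<bar>?u - ?v\<bar> \<le> A * norm (y - z)" .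
  have "?u \<le> A * A" "?v \<le> A * A"
    using assms A by (auto intro!: order_trans[OF cmod_hermitian_prod_le] mult_mono)
  then have add: "?u + ?v \<le> 2 * (A * A)"
    by linarith
  have "\<bar>?u\<^sup>2 - ?v\<^sup>2\<bar> = \<bar>?u - ?v\<bar> * (?u + ?v)"
    by (simp add: square_diff_square_factored power2_eq_square abs_mult mult.commute)
  also have "\<dots> \<le> (A * norm (y - z)) * (2 * (A * A))"
    using diff add A by (intro mult_mono) auto
  finally show ?thesis
    by (simp add: power3_eq_cube mult_ac)
qed

text \<open>The intermediate product is \<open>m * q'\<close>, so that the change from
  \<open>q\<close> to \<open>q'\<close> is weighted by the reference power \<open>m\<close>, as in
  \<open>direction_error\<close>, and the power change is weighted by
  \<open>q' \<le> B\<close>.\<close>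

lemma abs_mult_diff_le:
  fixes m m' q q' B D :: real
  assumes "0 \<le> m" "0 \<le> q'" "q' \<le> B" "\<bar>q' - q\<bar> \<le> D"
  shows "\<bar>m' * q' - m * q\<bar> \<le> B * \<bar>m' - m\<bar> + m * D"
proof -
  have "m' * q' - m * q = q' * (m' - m) + m * (q' - q)"
    by (simp add: algebra_simps)
  then have "\<bar>m' * q' - m * q\<bar> \<le> q' * \<bar>m' - m\<bar> + m * \<bar>q' - q\<bar>"
    using assms(1,2) abs_triangle_ineq[of "q' * (m' - m)" "m * (q' - q)"] by (simp add: abs_mult)
  also have "\<dots> \<le> B * \<bar>m' - m\<bar> + m * D"
    using assms by (intro add_mono mult_right_mono mult_left_mono) auto
  finally show ?thesis .
qed

text \<open>Stability of the rendered spectrum in a single direction. Later \<open>z'\<close> is the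
  estimate and \<open>z\<close> the best-approximating state, whose powers weight the direction
  error.\<close>

lemma render_diff_le:
  fixes a :: "'d \<Rightarrow> complex ^ 'n"
  assumes g: "0 \<le> g \<Omega>" "g \<Omega> \<le> gmax"
    and a: "\<And>\<Omega>. norm (a \<Omega>) \<le> A"
    and lip: "\<And>\<Omega> \<Omega>'. norm (a \<Omega> - a \<Omega>') \<le> L * da \<Omega> \<Omega>'"
    and los: "direction z' 0 = direction z 0"
    and mass: "\<And>n. n \<le> K \<Longrightarrow> 0 \<le> mass z n"
    and perm: "\<upsilon> permutes {1..K}"
  shows "\<bar>render g a K z' \<Omega> - render g a K z \<Omega>\<bar>
    \<le> gmax * A ^ 4 * power_error K \<upsilon> z' z + gmax * (2 * A ^ 3 * L) * direction_error da K \<upsilon> z' z"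
proof -
  have A: "0 \<le> A"
    using a norm_ge_zero order_trans by blast
  define q where "q \<phi> = (cmod (hermitian_prod (a \<Omega>) (a \<phi>)))\<^sup>2" for \<phi>
  define t where "t z n = mass z n * q (direction z n)" for z n
  have q: "0 \<le> q \<phi>" "q \<phi> \<le> A ^ 4" for \<phi>
    by (auto simp: q_def a intro: cmod_hermitian_prod_squared_le)
  have q_diff: "\<bar>q \<phi> - q \<psi>\<bar> \<le> 2 * A ^ 3 * L * da \<phi> \<psi>" for \<phi> \<psi>
  proof -
    have "\<bar>q \<phi> - q \<psi>\<bar> \<le> 2 * A ^ 3 * norm (a \<phi> - a \<psi>)"
      unfolding q_def by (intro cmod_hermitian_prod_squared_diff_le a)
    also have "\<dots> \<le> 2 * A ^ 3 * (L * da \<phi> \<psi>)"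
      using A by (intro mult_left_mono lip) auto
    finally show ?thesis
      by (simp add: mult.assoc)
  qed
  let ?e = "power_error K \<upsilon> z' z" and ?d = "direction_error da K \<upsilon> z' z"
  \<comment> \<open>The term of index 0 is split off because \<open>\<upsilon>\<close> permutes only
    \<open>{1..K}\<close>: the line-of-sight component is matched with itself.\<close>
  have render: "render g a K w \<Omega> = g \<Omega> * (t w 0 + (\<Sum>n=1..K. t w n))" for w
    unfolding render_def t_def q_def by (simp add: sum.atLeast_Suc_atMost)
  \<comment> \<open>Equal line-of-sight directions give equal values of \<open>q\<close>, hence
    \<open>D = 0\<close> and a pure power error.\<close>
  have t_0: "\<bar>t z' 0 - t z 0\<bar> \<le> A ^ 4 * \<bar>mass z' 0 - mass z 0\<bar>"
    using abs_mult_diff_le[where D = 0, OF mass[of 0] q(1) q(2)[of "direction z 0"]] los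
    by (simp add: t_def)
  have t_Suc: "\<bar>t z' (\<upsilon> n) - t z n\<bar> \<le> A ^ 4 * \<bar>mass z' (\<upsilon> n) - mass z n\<bar>
      + mass z n * (2 * A ^ 3 * L * da (direction z' (\<upsilon> n)) (direction z n))" if "n \<in> {1..K}" for n
    unfolding t_def using that by (intro abs_mult_diff_le mass q q_diff) auto
  \<comment> \<open>Reindexing by the permutation aligns each estimated component with its reference
    component before the sums are subtracted.\<close>
  have "(\<Sum>n=1..K. t z' n) = (\<Sum>n=1..K. t z' (\<upsilon> n))"
    using sum.permute[OF perm, of "t z'"] by (simp add: comp_def)
  then have "\<bar>(t z' 0 + (\<Sum>n=1..K. t z' n)) - (t z 0 + (\<Sum>n=1..K. t z n))\<bar>
      = \<bar>(t z' 0 - t z 0) + (\<Sum>n=1..K. t z' (\<upsilon> n) - t z n)\<bar>"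
    by (simp add: sum_subtractf algebra_simps)
  also have "\<dots> \<le> \<bar>t z' 0 - t z 0\<bar> + (\<Sum>n=1..K. \<bar>t z' (\<upsilon> n) - t z n\<bar>)"
    by (intro order_trans[OF abs_triangle_ineq] add_left_mono sum_abs)
  also have "\<dots> \<le> A ^ 4 * \<bar>mass z' 0 - mass z 0\<bar> + (\<Sum>n=1..K. A ^ 4 * \<bar>mass z' (\<upsilon> n) - mass z n\<bar>
      + mass z n * (2 * A ^ 3 * L * da (direction z' (\<upsilon> n)) (direction z n)))"
    by (intro add_mono t_0 sum_mono t_Suc)
  also have "\<dots> = A ^ 4 * ?e + 2 * A ^ 3 * L * ?d"
    by (simp add: power_error_def direction_error_def sum.distrib sum_distrib_left distrib_left mult_ac)
  finally have "\<bar>(t z' 0 + (\<Sum>n=1..K. t z' n)) - (t z 0 + (\<Sum>n=1..K. t z n))\<bar>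
      \<le> A ^ 4 * ?e + 2 * A ^ 3 * L * ?d" .
  then have "g \<Omega> * \<bar>(t z' 0 + (\<Sum>n=1..K. t z' n)) - (t z 0 + (\<Sum>n=1..K. t z n))\<bar>
      \<le> gmax * (A ^ 4 * ?e + 2 * A ^ 3 * L * ?d)"
    using g by (intro mult_mono) auto
  moreover have "\<bar>render g a K z' \<Omega> - render g a K z \<Omega>\<bar>
      = g \<Omega> * \<bar>(t z' 0 + (\<Sum>n=1..K. t z' n)) - (t z 0 + (\<Sum>n=1..K. t z n))\<bar>"
    unfolding render right_diff_distrib[symmetric] abs_mult using g by simp
  ultimately show ?thesis
    by (simp add: algebra_simps)
qed

lemma abs_le_max_norm: "finite G \<Longrightarrow> \<Omega> \<in> G \<Longrightarrow> \<bar>f \<Omega>\<bar> \<le> max_norm G f"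
  by (simp add: max_norm_def)

lemma max_norm_leI:
  assumes "finite G" "G \<noteq> {}" "\<And>\<Omega>. \<Omega> \<in> G \<Longrightarrow> \<bar>f \<Omega>\<bar> \<le> B"
  shows "max_norm G f \<le> B"
  using assms by (simp add: max_norm_def)

theorem proposition2:
  fixes g :: "'d::topological_space \<Rightarrow> real"
    and a :: "'d \<Rightarrow> complex ^ 'n"
    and da :: "'d \<Rightarrow> 'd \<Rightarrow> real"
    and gmax A La :: real
  assumes "continuous_on UNIV a"
    and "\<And>\<Omega> \<Omega>'. 0 \<le> da \<Omega> \<Omega>'"
    and "\<And>\<Omega>. 0 \<le> g \<Omega>"
    and "\<And>\<Omega>. g \<Omega> \<le> gmax"
    and "\<And>\<Omega>. norm (a \<Omega>) \<le> A"
    and "\<And>\<Omega> \<Omega>'. norm (a \<Omega> - a \<Omega>') \<le> La * da \<Omega> \<Omega>'"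
  shows "\<exists>Cm\<ge>0. \<exists>C\<Omega>\<ge>0.
    \<forall>(G :: 'd set) (P :: 'd \<Rightarrow> real) (K :: nat) (\<Omega>los :: 'd) (Z :: 'd state set)
      (zstar :: 'd state) (zhat :: 'd state) (\<upsilon> :: nat \<Rightarrow> nat).
      finite G \<longrightarrow> G \<noteq> {} \<longrightarrow>
      (\<forall>\<Omega>\<in>G. 0 \<le> P \<Omega>) \<longrightarrow>
      admissible_set K \<Omega>los Z \<longrightarrow>
      is_arg_min (fit_error g a G K P) (\<lambda>z. z \<in> Z) zstar \<longrightarrow>
      zhat \<in> renderer_states K \<Omega>los \<longrightarrow>
      \<upsilon> permutes {1..K} \<longrightarrow>
      max_norm G (\<lambda>\<Omega>. render g a K zhat \<Omega> - P \<Omega>)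
        \<le> fit_error g a G K P zstar
           + Cm * power_error K \<upsilon> zhat zstar
           + C\<Omega> * direction_error da K \<upsilon> zhat zstar"
proof -
  \<comment> \<open>Types are inhabited, so the bounds at any one direction give both signs.\<close>
  have gmax: "0 \<le> gmax" and A: "0 \<le> A"
    using assms(3-5) norm_ge_zero order_trans by blast+
  \<comment> \<open>\<open>La\<close> may be negative, when \<open>da\<close> vanishes identically.\<close>
  have lip: "norm (a \<Omega> - a \<Omega>') \<le> \<bar>La\<bar> * da \<Omega> \<Omega>'" for \<Omega> \<Omega>'
    by (rule order_trans[OF assms(6)]) (simp add: assms(2) mult_right_mono)
  \<comment> \<open>Both constants involve only \<open>gmax\<close>, \<open>A\<close> and
    \<open>La\<close>, which is what makes them uniform in the grid, the target, \<open>K\<close>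
    and the states.\<close>
  have bound: "max_norm G (\<lambda>\<Omega>. render g a K zhat \<Omega> - P \<Omega>) \<le> fit_error g a G K P zstar
      + gmax * A ^ 4 * power_error K \<upsilon> zhat zstar
      + gmax * (2 * A ^ 3 * \<bar>La\<bar>) * direction_error da K \<upsilon> zhat zstar"
    if G: "finite G" "G \<noteq> {}"
      and states: "zstar \<in> renderer_states K \<Omega>los" "zhat \<in> renderer_states K \<Omega>los"
      and perm: "\<upsilon> permutes {1..K}"
    for G P K \<Omega>los zstar zhat \<upsilon>
  proof (rule max_norm_leI[OF G])
    fix \<Omega> assume "\<Omega> \<in> G"
    then have "\<bar>P \<Omega> - render g a K zstar \<Omega>\<bar> \<le> fit_error g a G K P zstar"
      unfolding fit_error_def by (rule abs_le_max_norm[OF G(1)])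
    moreover have "\<bar>render g a K zhat \<Omega> - render g a K zstar \<Omega>\<bar>
        \<le> gmax * A ^ 4 * power_error K \<upsilon> zhat zstar
          + gmax * (2 * A ^ 3 * \<bar>La\<bar>) * direction_error da K \<upsilon> zhat zstar"
      using states by (intro render_diff_le assms lip perm) (auto simp: renderer_states_def)
    ultimately show "\<bar>render g a K zhat \<Omega> - P \<Omega>\<bar> \<le> fit_error g a G K P zstar
        + gmax * A ^ 4 * power_error K \<upsilon> zhat zstar
        + gmax * (2 * A ^ 3 * \<bar>La\<bar>) * direction_error da K \<upsilon> zhat zstar"
      \<comment> \<open>Triangle inequality through the value of \<open>render g a K zstar\<close>
        at \<Omega>.\<close>
      by linarith
  qed
  \<comment> \<open>A minimizer over \<open>Z\<close> lies in \<open>Z\<close>, hence has the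
    prescribed line-of-sight direction and nonnegative powers.\<close>
  have zstar: "zstar \<in> renderer_states K \<Omega>los"
    if "admissible_set K \<Omega>los Z" "is_arg_min f (\<lambda>z. z \<in> Z) zstar"
    for K \<Omega>los Z zstar and f :: "'d state \<Rightarrow> real"
    using that by (auto simp: admissible_set_def is_arg_min_def)
  show ?thesis
  \<comment> \<open>Here \<open>gmax\<close> bounds the element pattern and \<open>A ^ 4\<close> the
    squared array correlation.\<close>
  proof (rule exI[of _ "gmax * A ^ 4"], rule conjI)
    show "0 \<le> gmax * A ^ 4"
      using gmax by simp
    show "\<exists>C\<Omega>\<ge>0. \<forall>G P K \<Omega>los Z zstar zhat \<upsilon>.
      finite G \<longrightarrow> G \<noteq> {} \<longrightarrow> (\<forall>\<Omega>\<in>G. 0 \<le> P \<Omega>) \<longrightarrow> admissible_set K \<Omega>los Z \<longrightarrow>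
      is_arg_min (fit_error g a G K P) (\<lambda>z. z \<in> Z) zstar \<longrightarrow>
      zhat \<in> renderer_states K \<Omega>los \<longrightarrow> \<upsilon> permutes {1..K} \<longrightarrow>
      max_norm G (\<lambda>\<Omega>. render g a K zhat \<Omega> - P \<Omega>) \<le> fit_error g a G K P zstar
        + gmax * A ^ 4 * power_error K \<upsilon> zhat zstar + C\<Omega> * direction_error da K \<upsilon> zhat zstar"
    \<comment> \<open>This is \<open>gmax\<close> times the Lipschitz constant of the squared
      correlation; the absolute value of \<open>La\<close> keeps it nonnegative.\<close>
    proof (rule exI[of _ "gmax * (2 * A ^ 3 * \<bar>La\<bar>)"], intro conjI allI impI)
      show "0 \<le> gmax * (2 * A ^ 3 * \<bar>La\<bar>)"
        using gmax A by simp
    qed (rule bound[OF _ _ zstar])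
  qed
qed

end
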